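(* There is an absolute constant $c>0$ such that for all integers $1\le k<n$ there exist vectors $\boldsymbol\mu,\boldsymbol\nu\in\mathbb{R}_{\ge0}^n$ with $e_i(\boldsymbol\mu)=e_i(\boldsymbol\nu)$ for $i=1,\dots,k$ and \[ \frac{\nu_{\max}}{\mu_{\max}}\ge \beta_{k,n},\qquad\text{where}\quad \beta_{k,n}=\begin{cases} n^{c/k} & k\le\log n,\\ 1+c\left(\frac{\log\frac{2n}{k}}{k}\right)^2 & k>\log n.\end{cases}\]
   Context: For $\boldsymbol\mu\in\mathbb{R}^n$, $e_i(\boldsymbol\mu)=\sum_{T\subseteq[n],\,|T|=i}\prod_{j\in T}\mu_j$ is the $i$-th elementary symmetric polynomial of the coordinates, and $\mu_{\max}=\max_j\mu_j$ (similarly $\nu_{\max}$). *)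

theory Defs
  imports "HOL-Analysis.Analysis"
begin

text \<open>
  The dimension \<open>n\<close> is quantified after the absolute constant, so a vector in \<open>\<real>\<^sup>n\<close> is
  represented by a function \<open>nat \<Rightarrow> real\<close> of which only the values at \<open>1, \<dots>, n\<close> are used.
\<close>

definition elem_sym :: "nat \<Rightarrow> nat \<Rightarrow> (nat \<Rightarrow> real) \<Rightarrow> real" where
  "elem_sym n i \<mu> = (\<Sum>T | T \<subseteq> {1..n} \<and> card T = i. \<Prod>j\<in>T. \<mu> j)"

definition vec_max :: "nat \<Rightarrow> (nat \<Rightarrow> real) \<Rightarrow> real" where
  "vec_max n \<mu> = Max (\<mu> ` {1..n})"

definition gap_bound :: "real \<Rightarrow> nat \<Rightarrow> nat \<Rightarrow> real" where
  "gap_bound c k n =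
     (if real k \<le> ln (real n) then real n powr (c / real k)
      else 1 + c * (ln (2 * real n / real k) / real k)\<^sup>2)"

end

theory Submission
  imports Defs "HOL-Computational_Algebra.Formal_Power_Series" "HOL-Computational_Algebra.Polynomial"
begin

text \<open>
  By Newton's identities it suffices to find two nonnegative multisets of size \<open>n\<close> whose first \<open>k\<close>
  power sums agree. Extrapolating polynomials of degree at most \<open>k\<close> from \<open>0, \<dots>, k\<close> to \<open>2 * (k + 1)\<close>
  has integer weights of total size at most \<open>9 ^ (k + 1)\<close>; sorting the weights by sign gives such
  a pair with ratio \<open>2\<close> of the maxima. Power sums are multiplicative under the multiset of pairwise
  products, so the \<open>r\<close>-fold product of the pair has size \<open>9 ^ ((k + 1) * r)\<close> and ratio \<open>2 ^ r\<close>; this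
  settles the case that \<open>n\<close> is at least exponential in \<open>k\<close>.

  For larger \<open>k\<close>, replace every element of a pair for a smaller degree \<open>l\<close>, scaled into \<open>[0, 1]\<close>, by
  its \<open>m\<close> preimages under the Chebyshev polynomial of degree \<open>m\<close>. The size grows by the factor \<open>m\<close>, the
  number of matching moments (including the zeroth) also grows by the factor \<open>m\<close>, and the ratio \<open>2\<close> turns
  into \<open>1 + \<Omega>(1 / m\<^sup>2)\<close>. Taking \<open>l\<close> of order \<open>ln (n / k)\<close> and \<open>m\<close> of order \<open>k / l\<close> gives the bound.
\<close>

section \<open>Pairs of lists with equal moments\<close>

text \<open>Lists serve as multisets. Testing against all polynomials of bounded degree, not only
  monomials, lets substitutions be absorbed by \<open>pcompose\<close>. The product form
  \<open>B * x \<le> y\<close> avoids dividing by a maximum of \<open>xs\<close>, which may be zero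
  when \<open>k = 0\<close>.\<close>

definition moment_gap :: "nat \<Rightarrow> nat \<Rightarrow> real \<Rightarrow> bool" where
  "moment_gap k n B \<longleftrightarrow> (\<exists>xs ys. length xs = n \<and> length ys = n \<and>
     (\<forall>x\<in>set xs. 0 \<le> x) \<and> (\<forall>y\<in>set ys. 0 \<le> y) \<and>
     (\<forall>p. degree p \<le> k \<longrightarrow> (\<Sum>x\<leftarrow>xs. poly p x) = (\<Sum>y\<leftarrow>ys. poly p y)) \<and>
     (\<exists>y\<in>set ys. 0 < y \<and> (\<forall>x\<in>set xs. B * x \<le> y)))"

lemma moment_gapI:
  assumes "length xs = n" "length ys = n" "\<And>x. x \<in> set xs \<Longrightarrow> 0 \<le> x" "\<And>y. y \<in> set ys \<Longrightarrow> 0 \<le> y"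
    and "\<And>p. degree p \<le> k \<Longrightarrow> (\<Sum>x\<leftarrow>xs. poly p x) = (\<Sum>y\<leftarrow>ys. poly p y)"
    and "y \<in> set ys" "0 < y" "\<And>x. x \<in> set xs \<Longrightarrow> B * x \<le> y"
  shows "moment_gap k n B"
  unfolding moment_gap_def using assms by blast

lemma moment_gapE:
  \<comment> \<open>The witness can be replaced by the maximum of \<open>ys\<close>. The additional
    last fact is what puts both lists into \<open>[0, y]\<close> when
    \<open>2 \<le> B\<close>.\<close>
  assumes "moment_gap k n B"
  obtains xs ys y where "length xs = n" "length ys = n"
    "\<And>x. x \<in> set xs \<Longrightarrow> 0 \<le> x" "\<And>y. y \<in> set ys \<Longrightarrow> 0 \<le> y"
    "\<And>p. degree p \<le> k \<Longrightarrow> (\<Sum>x\<leftarrow>xs. poly p x) = (\<Sum>y\<leftarrow>ys. poly p y)"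
    "y \<in> set ys" "0 < y" "\<And>x. x \<in> set xs \<Longrightarrow> B * x \<le> y"
    "\<And>z. z \<in> set ys \<Longrightarrow> z \<le> y"
proof -
  from assms obtain xs ys y where *: "length xs = n" "length ys = n"
    "\<And>x. x \<in> set xs \<Longrightarrow> 0 \<le> x" "\<And>y. y \<in> set ys \<Longrightarrow> 0 \<le> y"
    "\<And>p. degree p \<le> k \<Longrightarrow> (\<Sum>x\<leftarrow>xs. poly p x) = (\<Sum>y\<leftarrow>ys. poly p y)"
    "y \<in> set ys" "0 < y" "\<And>x. x \<in> set xs \<Longrightarrow> B * x \<le> y"
    unfolding moment_gap_def by blast
  let ?m = "Max (set ys)"
  have m: "?m \<in> set ys" "\<And>z. z \<in> set ys \<Longrightarrow> z \<le> ?m" using *(6) by (auto intro!: Max_in)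
  show thesis
  proof (rule that[OF *(1-5) m(1)])
    show "0 < ?m" using m(2)[OF *(6)] *(7) by linarith
    show "B * x \<le> ?m" if "x \<in> set xs" for x using m(2)[OF *(6)] *(8)[OF that] by linarith
    show "z \<le> ?m" if "z \<in> set ys" for z using m(2) that .
  qed
qed

lemma moment_gap_mono:
  assumes "moment_gap k n B" "k' \<le> k" "n \<le> n'" "B' \<le> B"
  shows "moment_gap k' n' B'"
  using assms(1)
proof (rule moment_gapE)
  fix xs ys :: "real list" and y :: real
  assume *: "length xs = n" "length ys = n" "\<And>x. x \<in> set xs \<Longrightarrow> 0 \<le> x" "\<And>y. y \<in> set ys \<Longrightarrow> 0 \<le> y"
    "\<And>p. degree p \<le> k \<Longrightarrow> (\<Sum>x\<leftarrow>xs. poly p x) = (\<Sum>y\<leftarrow>ys. poly p y)"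
    "y \<in> set ys" "0 < y" "\<And>x. x \<in> set xs \<Longrightarrow> B * x \<le> y"
  \<comment> \<open>Appending the same zeros to both lists adds the same multiple of
    \<open>poly p 0\<close> to both sums.\<close>
  define zs :: "real list" where "zs = replicate (n' - n) 0"
  have z: "z = 0" if "z \<in> set zs" for z using that by (auto simp: zs_def)
  show ?thesis
  proof (rule moment_gapI[where xs = "xs @ zs" and ys = "ys @ zs" and y = y])
    show "length (xs @ zs) = n'" "length (ys @ zs) = n'" using * assms(3) by (auto simp: zs_def)
    show "B' * x \<le> y" if "x \<in> set (xs @ zs)" for x
    proof (cases "x \<in> set xs")
      case True
      then have "B' * x \<le> B * x" using assms(4) *(3) by (simp add: mult_right_mono)
      then show ?thesis using *(8)[OF True] by linarith
    next
      case False
      then have "x = 0" using that z by auto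
      then show ?thesis using *(7) by simp
    qed
  qed (use * z assms(2) in force)+
qed

section \<open>Products of pairs\<close>

lemma sum_list_concat_map:
  fixes f :: "'b \<Rightarrow> 'c::comm_monoid_add"
  shows "(\<Sum>z\<leftarrow>concat (map h xs). f z) = (\<Sum>x\<leftarrow>xs. \<Sum>z\<leftarrow>h x. f z)"
  by (induction xs) auto

lemma sum_list_swap:
  fixes f :: "'a \<Rightarrow> 'b \<Rightarrow> 'c::comm_monoid_add"
  shows "(\<Sum>x\<leftarrow>xs. \<Sum>y\<leftarrow>ys. f x y) = (\<Sum>y\<leftarrow>ys. \<Sum>x\<leftarrow>xs. f x y)"
  by (induction xs) (auto simp: sum_list_addf)

text \<open>For fixed \<open>u\<close>, the map \<open>v \<mapsto> p (u * v)\<close> is again a polynomial of degree at most \<open>k\<close>, so the two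
  factors of the product multiset can be exchanged one after the other.\<close>

lemma moment_gap_mult:
  assumes "moment_gap k n B" "moment_gap k n' B'" "0 \<le> B" "0 \<le> B'"
  shows "moment_gap k (n * n') (B * B')"
  using assms(1)
proof (rule moment_gapE)
  fix xs ys :: "real list" and y :: real
  assume 1: "length xs = n" "length ys = n" "\<And>x. x \<in> set xs \<Longrightarrow> 0 \<le> x" "\<And>y. y \<in> set ys \<Longrightarrow> 0 \<le> y"
    "\<And>p. degree p \<le> k \<Longrightarrow> (\<Sum>x\<leftarrow>xs. poly p x) = (\<Sum>y\<leftarrow>ys. poly p y)"
    "y \<in> set ys" "0 < y" "\<And>x. x \<in> set xs \<Longrightarrow> B * x \<le> y"
  obtain xs' ys' y' where 
    2: "length xs' = n'" "length ys' = n'" "\<And>x. x \<in> set xs' \<Longrightarrow> 0 \<le> x" "\<And>y. y \<in> set ys' \<Longrightarrow> 0 \<le> y"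
    "\<And>p. degree p \<le> k \<Longrightarrow> (\<Sum>x\<leftarrow>xs'. poly p x) = (\<Sum>y\<leftarrow>ys'. poly p y)"
    "y' \<in> set ys'" "0 < y'" "\<And>x. x \<in> set xs' \<Longrightarrow> B' * x \<le> y'"
    using assms(2) by (rule moment_gapE) blast
  define T :: "real list \<Rightarrow> real list \<Rightarrow> real list"
    where "T us vs = concat (map (\<lambda>u. map ((*) u) vs) us)" for us vs
  have len: "length (T us vs) = length us * length vs" for us vs
    by (simp add: T_def length_concat o_def sum_list_triv)
  have set: "set (T us vs) = (\<lambda>(u, v). u * v) ` (set us \<times> set vs)" for us vs
    by (auto simp: T_def)
  have T: "(\<Sum>z\<leftarrow>T us vs. poly p z) = (\<Sum>u\<leftarrow>us. \<Sum>v\<leftarrow>vs. poly p (u * v))" for us vs p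
    by (simp add: T_def sum_list_concat_map o_def)
  have scale: "poly (pcompose p [:0, u:]) = (\<lambda>v. poly p (u * v))" for p u
    by (simp add: fun_eq_iff poly_pcompose mult.commute)
  have deg: "degree (pcompose p [:0, u:]) \<le> k" if "degree p \<le> k" for p :: "real poly" and u
    using that by (simp add: degree_pcompose)
  show ?thesis
  proof (rule moment_gapI[where xs = "T xs xs'" and ys = "T ys ys'" and y = "y * y'"])
    fix p :: "real poly" assume p: "degree p \<le> k"
    have "(\<Sum>z\<leftarrow>T xs xs'. poly p z) = (\<Sum>u\<leftarrow>xs. \<Sum>v\<leftarrow>ys'. poly p (u * v))"
      unfolding T using 2(5)[OF deg[OF p]] by (simp add: scale)
    also have "\<dots> = (\<Sum>v\<leftarrow>ys'. \<Sum>u\<leftarrow>xs. poly p (v * u))"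
      by (subst sum_list_swap) (simp add: mult.commute)
    also have "\<dots> = (\<Sum>v\<leftarrow>ys'. \<Sum>u\<leftarrow>ys. poly p (v * u))"
      using 1(5)[OF deg[OF p]] by (simp add: scale)
    also have "\<dots> = (\<Sum>z\<leftarrow>T ys ys'. poly p z)"
      unfolding T by (subst sum_list_swap) (simp add: mult.commute)
    finally show "(\<Sum>z\<leftarrow>T xs xs'. poly p z) = (\<Sum>z\<leftarrow>T ys ys'. poly p z)" .
  next
    fix z assume "z \<in> set (T xs xs')"
    then obtain u v where z: "u \<in> set xs" "v \<in> set xs'" "z = u * v" by (auto simp: set)
    have "(B * u) * (B' * v) \<le> y * y'"
      using 1 2 z assms by (intro mult_mono) auto
    then show "B * B' * z \<le> y * y'" by (simp add: z mult_ac)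
  qed (use 1 2 in \<open>auto simp: len set\<close>)
qed

lemma moment_gap_power:
  assumes "moment_gap k n B" "0 \<le> B" "1 \<le> r"
  shows "moment_gap k (n ^ r) (B ^ r)"
  using assms(3)
proof (induction r rule: dec_induct)
  case (step r)
  then show ?case using moment_gap_mult[OF assms(1) step.IH] assms(2) by simp
qed (use assms in simp)

section \<open>Integer extrapolation and a pair with ratio 2\<close>

lemma degree_shift_diff:
  fixes p :: "real poly"
  assumes "degree p \<le> Suc k"
  shows "degree (pcompose p [:1, 1:] - p) \<le> k"
proof (cases "degree p = 0")
  case True
  then obtain a where "p = [:a:]" by (meson degree_eq_zeroE)
  then show ?thesis by simp
next
  case False
  have l: "degree (pcompose p [:1, 1:]) = degree p" by (simp add: degree_pcompose)
  have "lead_coeff (pcompose p [:1, 1:]) = lead_coeff p" by (subst lead_coeff_comp) auto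
  then have c: "coeff (pcompose p [:1, 1:] - p) (degree p) = 0" using l by simp
  have "coeff (pcompose p [:1, 1:] - p) i = 0" if "i > k" for i
  proof (cases "i = degree p")
    case False
    then have "i > degree p" using that assms by linarith
    then show ?thesis using l by (simp add: coeff_eq_0)
  qed (use c in simp)
  then show ?thesis by (intro degree_le) auto
qed

text \<open>The bound \<open>3 ^ N\<close> comes from \<open>p (N + 1) = p N + \<Delta>p N\<close>, where \<open>\<Delta>p N\<close> is extrapolated from
  the differences \<open>p (i + 1) - p i\<close> and thus costs twice the bound for \<open>N\<close>.\<close>

lemma integer_extrapolation:
  "\<exists>w :: nat \<Rightarrow> int. (\<forall>p :: real poly. degree p \<le> k \<longrightarrow>
      poly p (real N) = (\<Sum>i\<le>k. real_of_int (w i) * poly p (real i))) \<and>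
      (\<Sum>i\<le>k. real_of_int \<bar>w i\<bar>) \<le> 3 ^ N"
proof (induction N arbitrary: k)
  case 0
  define w :: "nat \<Rightarrow> int" where "w i = of_bool (i = 0)" for i
  have "(\<Sum>i\<le>k. real_of_int (w i) * f i) = f 0" for f
    by (subst sum.remove[of _ 0]) (simp_all add: w_def)
  moreover have "(\<Sum>i\<le>k. real_of_int \<bar>w i\<bar>) = 1"
    by (subst sum.remove[of _ 0]) (simp_all add: w_def)
  ultimately show ?case by (intro exI[of _ w]) simp
next
  case (Suc N)
  obtain w where w: "\<And>p :: real poly. degree p \<le> k \<Longrightarrow>
      poly p (real N) = (\<Sum>i\<le>k. real_of_int (w i) * poly p (real i))"
    "(\<Sum>i\<le>k. real_of_int \<bar>w i\<bar>) \<le> 3 ^ N" using Suc by blast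
  show ?case
  proof (cases k)
    case 0
    have "poly p (real (Suc N)) = poly p (real N)" if "degree p \<le> 0" for p :: "real poly"
      using that by (auto elim: degree_eq_zeroE)
    moreover have "(3::real) ^ N \<le> 3 ^ Suc N" by simp
    ultimately show ?thesis using w 0 by (intro exI[of _ w]) (metis order_trans)
  next
    case (Suc l)
    obtain v where v: "\<And>p :: real poly. degree p \<le> l \<Longrightarrow>
        poly p (real N) = (\<Sum>i\<le>l. real_of_int (v i) * poly p (real i))"
      "(\<Sum>i\<le>l. real_of_int \<bar>v i\<bar>) \<le> 3 ^ N" using Suc.IH by blast
    \<comment> \<open>\<open>a\<close> is \<open>v\<close> moved up by one node, \<open>b\<close> is
      \<open>v\<close> with weight zero at the node \<open>k\<close>. Together they express the
      weights of the difference polynomial in terms of values of \<open>p\<close>, so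
      \<open>w + a - b\<close> extrapolates to \<open>Suc N\<close>.\<close>
    define a where "a i = (if i = 0 then 0 else v (i - 1))" for i
    define b where "b i = (if i \<le> l then v i else 0)" for i
    have suma: "(\<Sum>i\<le>k. f i (a i)) = (\<Sum>i\<le>l. f (Suc i) (v i))"
      if "\<And>i. f i 0 = 0" for f :: "nat \<Rightarrow> int \<Rightarrow> real"
      unfolding Suc sum.atMost_Suc_shift by (simp add: a_def that)
    have sumb: "(\<Sum>i\<le>k. f i (b i)) = (\<Sum>i\<le>l. f i (v i))"
      if "\<And>i. f i 0 = 0" for f :: "nat \<Rightarrow> int \<Rightarrow> real"
      unfolding Suc sum.atMost_Suc by (simp add: b_def that)
    have "poly p (real (Suc N)) = (\<Sum>i\<le>k. real_of_int (w i + a i - b i) * poly p (real i))"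
      if p: "degree p \<le> k" for p :: "real poly"
    proof -
      let ?q = "pcompose p [:1, 1:] - p"
      have "poly p (real (Suc N)) = poly p (real N) + poly ?q (real N)"
        by (simp add: poly_pcompose add.commute)
      also have "poly ?q (real N) = (\<Sum>i\<le>l. real_of_int (v i) * poly ?q (real i))"
        using degree_shift_diff p Suc by (intro v(1)) auto
      also have "\<dots> = (\<Sum>i\<le>l. real_of_int (v i) * poly p (real (Suc i))) - (\<Sum>i\<le>l. real_of_int (v i) * poly p (real i))"
        by (simp add: poly_pcompose algebra_simps sum_subtractf)
      also have "\<dots> = (\<Sum>i\<le>k. real_of_int (a i) * poly p (real i)) - (\<Sum>i\<le>k. real_of_int (b i) * poly p (real i))"
        using suma[of "\<lambda>i z. real_of_int z * poly p (real i)"]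
          sumb[of "\<lambda>i z. real_of_int z * poly p (real i)"] by simp
      finally show ?thesis by (simp add: w(1)[OF p] algebra_simps sum.distrib sum_subtractf)
    qed
    moreover have "(\<Sum>i\<le>k. real_of_int \<bar>w i + a i - b i\<bar>) \<le> 3 ^ Suc N"
    proof -
      have "(\<Sum>i\<le>k. real_of_int \<bar>w i + a i - b i\<bar>) \<le> (\<Sum>i\<le>k. real_of_int \<bar>w i\<bar> + real_of_int \<bar>a i\<bar> + real_of_int \<bar>b i\<bar>)"
        by (intro sum_mono) linarith
      also have "\<dots> = (\<Sum>i\<le>k. real_of_int \<bar>w i\<bar>) + (\<Sum>i\<le>l. real_of_int \<bar>v i\<bar>) + (\<Sum>i\<le>l. real_of_int \<bar>v i\<bar>)"
        using suma[of "\<lambda>i z. real_of_int \<bar>z\<bar>"] sumb[of "\<lambda>i z. real_of_int \<bar>z\<bar>"] by (simp add: sum.distrib)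
      also have "\<dots> \<le> 3 ^ Suc N" using w(2) v(2) by simp
      finally show ?thesis .
    qed
    ultimately show ?thesis by (intro exI[of _ "\<lambda>i. w i + a i - b i"] conjI allI impI)
  qed
qed

lemma moment_gap_two: "moment_gap k (9 ^ Suc k) 2"
proof -
  \<comment> \<open>Twice the largest node \<open>k\<close> would do for the ratio; the extra 2
    keeps \<open>N\<close> positive when \<open>k = 0\<close>. Moreover
    \<open>3 ^ N = 9 ^ Suc k\<close>.\<close>
  define N where "N = 2 * Suc k"
  obtain w :: "nat \<Rightarrow> int" where w: "\<And>p :: real poly. degree p \<le> k \<Longrightarrow>
      poly p (real N) = (\<Sum>i\<le>k. real_of_int (w i) * poly p (real i))"
    and wN: "(\<Sum>i\<le>k. real_of_int \<bar>w i\<bar>) \<le> 3 ^ N" using integer_extrapolation by blast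
  \<comment> \<open>\<open>nat\<close> cuts negative weights off to zero, so \<open>L w\<close> and
    \<open>L (\<lambda>i. - w i)\<close> collect the positive and the negative weights as
    multiplicities.\<close>
  define L where "L v = concat (map (\<lambda>i. replicate (nat (v i)) (real i)) [0..<Suc k])"
    for v :: "nat \<Rightarrow> int"
  define xs where "xs = L w"
  define ys where "ys = real N # L (\<lambda>i. - w i)"
  have L: "(\<Sum>x\<leftarrow>L v. f x) = (\<Sum>i\<le>k. real (nat (v i)) * f (real i))" for v and f :: "real \<Rightarrow> real"
    unfolding L_def sum_list_concat_map interv_sum_list_conv_sum_set_nat
    by (simp add: sum_list_replicate atLeast0LessThan lessThan_Suc_atMost flip: lessThan_Suc_atMost)
  have setL: "x \<in> set (L v) \<Longrightarrow> \<exists>i\<le>k. x = real i" for x v by (auto simp: L_def)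
  have nonneg: "x \<in> set (L v) \<Longrightarrow> 0 \<le> x" for x v using setL by fastforce
  have eq: "(\<Sum>x\<leftarrow>xs. poly p x) = (\<Sum>y\<leftarrow>ys. poly p y)" if "degree p \<le> k" for p
  proof -
    have "real (nat (w i)) = real (nat (- w i)) + real_of_int (w i)" for i by linarith
    then show ?thesis
      by (simp add: xs_def ys_def L w[OF that] algebra_simps sum.distrib)
  qed
  have len: "length xs = length ys"
    using eq[of "[:1:]"] by (simp add: sum_list_triv)
  have "real (length xs) = (\<Sum>i\<le>k. real (nat (w i)))"
    using L[of "\<lambda>_. 1" w] by (simp add: xs_def sum_list_triv)
  also have "\<dots> \<le> (\<Sum>i\<le>k. real_of_int \<bar>w i\<bar>)" by (intro sum_mono) linarith
  also note wN
  also have "(3::real) ^ N = real (9 ^ Suc k)" by (simp only: N_def power_mult) simp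
  finally have n: "length xs \<le> 9 ^ Suc k" by (simp only: of_nat_le_iff)
  have "moment_gap k (length xs) 2"
  proof (rule moment_gapI[where xs = xs and ys = ys and y = "real N"])
    show "2 * x \<le> real N" if "x \<in> set xs" for x using setL that by (fastforce simp: xs_def N_def)
  qed (use len eq nonneg in \<open>auto simp: xs_def ys_def N_def\<close>)
  then show ?thesis by (rule moment_gap_mono) (use n in auto)
qed

section \<open>Cosine sums over Chebyshev preimages\<close>

lemma abs_sin_of_nat_mult_le: "\<bar>sin (real m * x)\<bar> \<le> real m * \<bar>sin x\<bar>"
proof (induction m)
  case (Suc m)
  have "\<bar>sin (real (Suc m) * x)\<bar> = \<bar>sin (real m * x) * cos x + cos (real m * x) * sin x\<bar>"
    by (simp add: sin_add algebra_simps)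
  also have "\<dots> \<le> \<bar>sin (real m * x)\<bar> * \<bar>cos x\<bar> + \<bar>cos (real m * x)\<bar> * \<bar>sin x\<bar>"
    by (metis abs_mult abs_triangle_ineq)
  also have "\<dots> \<le> \<bar>sin (real m * x)\<bar> * 1 + 1 * \<bar>sin x\<bar>"
    by (intro add_mono mult_left_mono mult_right_mono) auto
  finally show ?case using Suc by (simp add: algebra_simps)
qed simp

text \<open>These are the Chebyshev polynomials, obtained from their three-term recurrence.\<close>

lemma cos_of_nat_mult_poly:
  "\<exists>q :: real poly. degree q \<le> l \<and> (\<forall>x. poly q (cos x) = cos (real l * x))"
proof (induction l rule: induct_nat_012)
  case 0
  show ?case by (rule exI[of _ 1]) simp
next
  case 1
  show ?case by (rule exI[of _ "[:0, 1:]"]) simp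
next
  case (ge2 l)
  then obtain q r :: "real poly" where q: "degree q \<le> l" "\<And>x. poly q (cos x) = cos (real l * x)"
    and r: "degree r \<le> Suc l" "\<And>x. poly r (cos x) = cos (real (Suc l) * x)" by blast
  have "poly ([:0, 2:] * r - q) (cos x) = cos (real (Suc (Suc l)) * x)" for x
    using cos_add[of "real (Suc l) * x" x] cos_diff[of "real (Suc l) * x" x]
    by (simp add: q r algebra_simps)
  moreover have "degree ([:0, 2:] * r - q) \<le> Suc (Suc l)"
    using q(1) r(1) degree_mult_le[of "[:0, 2:]" r] by (intro degree_diff_le) auto
  ultimately show ?case by blast
qed

text \<open>The sum is the real part of a geometric series in an \<open>m\<close>-th root of unity
  \<open>z\<close>; it vanishes unless \<open>z = 1\<close>, that is, unless \<open>m\<close>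
  divides \<open>l\<close>.\<close>

lemma sum_cos_rotations:
  assumes "0 < m"
  shows "(\<Sum>j<m. cos (real l * ((x + 2 * pi * real j) / real m))) =
    (if m dvd l then real m * cos (real (l div m) * x) else 0)"
proof -
  define z where "z = cis (2 * pi * real l / real m)"
  have z: "z = exp (2 * of_real pi * \<i> * of_nat l / of_nat m)"
    by (simp add: z_def cis_conv_exp algebra_simps)
  have z1: "z = 1 \<longleftrightarrow> m dvd l" unfolding z using complex_root_unity_eq_1[of m l] assms by simp
  have zm: "z ^ m = 1" using assms by (simp add: z_def Complex.DeMoivre)
  have "(\<Sum>j<m. cos (real l * ((x + 2 * pi * real j) / real m))) = Re (\<Sum>j<m. cis (real l * x / real m) * z ^ j)"
    by (simp add: z_def Complex.DeMoivre cis_mult add_divide_distrib distrib_left algebra_simps)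
  also have "\<dots> = Re (cis (real l * x / real m) * (\<Sum>j<m. z ^ j))" by (simp add: sum_distrib_left)
  also have "\<dots> = (if m dvd l then real m * cos (real (l div m) * x) else 0)"
  proof (cases "m dvd l")
    case True
    then show ?thesis using z1 assms by (auto simp: real_of_nat_div)
  next
    case False
    then have "(\<Sum>j<m. z ^ j) = 0" using z1 zm by (simp add: geometric_sum)
    then show ?thesis using False by simp
  qed
  finally show ?thesis .
qed

text \<open>Expand \<open>p (cos t)\<close> into cosines of multiples of \<open>t\<close>. Summation
  keeps only the frequencies \<open>l\<close> divisible by \<open>m\<close> and turns them into
  \<open>l div m\<close>, which is at most \<open>k\<close>.\<close>

lemma sum_poly_cos_rotations:
  fixes p :: "real poly"
  assumes "0 < m" and "degree p < m * Suc k"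
  shows "\<exists>g :: real poly. degree g \<le> k \<and>
    (\<forall>x. (\<Sum>j<m. poly p (cos ((x + 2 * pi * real j) / real m))) = poly g (cos x))"
proof -
  define P where "P f \<longleftrightarrow> (\<exists>g :: real poly. degree g \<le> k \<and>
    (\<forall>x. (\<Sum>j<m. f ((x + 2 * pi * real j) / real m)) = poly g (cos x)))" for f :: "real \<Rightarrow> real"
  have add: "P (\<lambda>t. f t + h t)" if "P f" "P h" for f h
  proof -
    from that obtain q r where "degree q \<le> k" "degree r \<le> k"
      "\<And>x. (\<Sum>j<m. f ((x + 2 * pi * real j) / real m)) = poly q (cos x)"
      "\<And>x. (\<Sum>j<m. h ((x + 2 * pi * real j) / real m)) = poly r (cos x)" unfolding P_def by blast
    then show ?thesis unfolding P_def
      by (intro exI[of _ "q + r"]) (auto simp: sum.distrib intro: degree_add_le)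
  qed
  have scale: "P (\<lambda>t. c * f t)" if "P f" for c f
  proof -
    from that obtain q where "degree q \<le> k"
      "\<And>x. (\<Sum>j<m. f ((x + 2 * pi * real j) / real m)) = poly q (cos x)" unfolding P_def by blast
    then show ?thesis unfolding P_def
      by (intro exI[of _ "smult c q"]) (auto simp: sum_distrib_left [symmetric] intro: order_trans[OF degree_smult_le])
  qed
  have cos: "P (\<lambda>t. cos (real l * t))" if l: "l < m * Suc k" for l
  proof (cases "m dvd l")
    case True
    obtain q :: "real poly" where q: "degree q \<le> l div m" "\<And>x. poly q (cos x) = cos (real (l div m) * x)"
      using cos_of_nat_mult_poly by blast
    have "l div m < Suc k" using l assms(1) by (simp add: div_less_iff_less_mult mult.commute)
    then have "degree (smult (real m) q) \<le> k" using q(1) degree_smult_le[of "real m" q] by linarith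
    then show ?thesis unfolding P_def sum_cos_rotations[OF assms(1)]
      by (intro exI[of _ "smult (real m) q"]) (use True q(2) in simp)
  next
    case False
    then show ?thesis unfolding P_def sum_cos_rotations[OF assms(1)]
      by (intro exI[of _ 0]) simp
  qed
  \<comment> \<open>The additional cosine factor makes the induction on \<open>i\<close> work:
    product-to-sum trades one power of \<open>cos t\<close> for frequencies \<open>l + 1\<close> and
    \<open>l - 1\<close>, and \<open>i + l\<close> does not grow. For \<open>l = 0\<close> the power
    itself becomes frequency 1.\<close>
  have pow_cos: "P (\<lambda>t. cos t ^ i * cos (real l * t))" if "i + l < m * Suc k" for i l
    using that
  proof (induction i arbitrary: l)
    case (Suc i)
    show ?case
    proof (cases l)
      case 0
      then show ?thesis using Suc.IH[of 1] Suc.prems by (simp add: mult.commute)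
    next
      case (Suc l')
      have "cos t ^ Suc i * cos (real l * t) =
          1 / 2 * (cos t ^ i * cos (real (Suc l) * t)) + 1 / 2 * (cos t ^ i * cos (real l' * t))" for t
      proof -
        have "cos (real (Suc l) * t) + cos (real l' * t) = 2 * cos t * cos (real l * t)"
          using cos_add[of "real l * t" t] cos_diff[of "real l * t" t] by (simp add: Suc algebra_simps)
        moreover have "1 / 2 * (cos t ^ i * cos (real (Suc l) * t)) + 1 / 2 * (cos t ^ i * cos (real l' * t))
           = 1 / 2 * cos t ^ i * (cos (real (Suc l) * t) + cos (real l' * t))" by (simp only: algebra_simps)
        ultimately show ?thesis by simp
      qed
      then show ?thesis
        using add[OF scale[OF Suc.IH] scale[OF Suc.IH], of "Suc l" l' "1 / 2" "1 / 2"] Suc Suc.prems by simp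
    qed
  qed (use cos in simp)
  have "P (\<lambda>t. \<Sum>i\<in>I. coeff p i * cos t ^ i)" if "finite I" "I \<subseteq> {..degree p}" for I
    using that
  proof (induction I rule: finite_induct)
    case empty
    show ?case unfolding P_def by (intro exI[of _ 0]) simp
  next
    case (insert i I)
    have "P (\<lambda>t. coeff p i * cos t ^ i)"
      using scale[OF pow_cos[of i 0]] insert.prems assms(2) by simp
    then show ?case using insert add by simp
  qed
  from this[of "{..degree p}"] show ?thesis unfolding P_def by (simp add: poly_altdef)
qed

lemma cos_le_cos_of_between:
  fixes x d :: real
  assumes "0 \<le> d" "d \<le> x" "x \<le> 2 * pi - d"
  shows "cos x \<le> cos d"
proof (cases "x \<le> pi")
  case True
  then show ?thesis using assms by (intro cos_monotone_0_pi_le) auto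
next
  case False
  have "cos (2 * pi - x) \<le> cos d" using assms False by (intro cos_monotone_0_pi_le) auto
  then show ?thesis by (simp add: cos_diff)
qed

text \<open>By the half-angle formula this is a lower bound for the sine of
  \<open>pi / (6 * m)\<close>, which follows from sin(pi / 6) = 1 / 2 and
  \<open>abs_sin_of_nat_mult_le\<close>.\<close>

lemma cos_pi_div_le_one_minus:
  assumes "1 \<le> m"
  shows "cos (pi / (3 * real m)) \<le> 1 - 1 / (2 * (real m)\<^sup>2)"
proof -
  define s where "s = sin (pi / (6 * real m))"
  have "1 / 2 \<le> real m * \<bar>s\<bar>"
    using abs_sin_of_nat_mult_le[of m "pi / (6 * real m)"] assms by (simp add: s_def sin_30)
  then have "(1 / 2)\<^sup>2 \<le> (real m * \<bar>s\<bar>)\<^sup>2" by (intro power_mono) auto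
  then have "1 / (4 * (real m)\<^sup>2) \<le> s\<^sup>2"
    using assms by (simp add: power_mult_distrib divide_simps mult.commute)
  moreover have "cos (pi / (3 * real m)) = 1 - 2 * s\<^sup>2"
    using cos_double_sin[of "pi / (6 * real m)"] by (simp add: s_def)
  ultimately show ?thesis by simp
qed

section \<open>Chebyshev preimages of a pair\<close>

text \<open>The \<open>Suc k\<close> matching moments, counted with the zeroth, become
  \<open>m * Suc k\<close>, hence the \<open>- 1\<close> in the degree. An entry
  \<open>u \<le> y / 2\<close> has arccosine at least pi / 3, so its preimage angles stay
  \<open>pi / (3 * m)\<close> away from 0 and 2 pi, whereas \<open>y\<close> has the preimage angle
  0.\<close>

lemma moment_gap_chebyshev:
  assumes "moment_gap k n 2" "1 \<le> m"
  shows "moment_gap (m * Suc k - 1) (n * m) (1 + 1 / (4 * (real m)\<^sup>2))"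
  using assms(1)
proof (rule moment_gapE)
  fix xs ys :: "real list" and y :: real
  assume *: "length xs = n" "length ys = n" "\<And>x. x \<in> set xs \<Longrightarrow> 0 \<le> x" "\<And>y. y \<in> set ys \<Longrightarrow> 0 \<le> y"
    "\<And>p. degree p \<le> k \<Longrightarrow> (\<Sum>x\<leftarrow>xs. poly p x) = (\<Sum>y\<leftarrow>ys. poly p y)"
    "y \<in> set ys" "0 < y" "\<And>x. x \<in> set xs \<Longrightarrow> 2 * x \<le> y" "\<And>z. z \<in> set ys \<Longrightarrow> z \<le> y"
  \<comment> \<open>\<open>r u 0, \<dots>, r u (m - 1)\<close> are the Chebyshev preimages of \<open>u / y\<close>, shifted by \<open>1\<close> to be nonnegative.\<close>
  define r where "r u j = 1 + cos ((arccos (u / y) + 2 * pi * real j) / real m)" for u j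
  define C where "C us = concat (map (\<lambda>u. map (r u) [0..<m]) us)" for us
  have len: "length (C us) = length us * m" for us
    by (simp add: C_def length_concat o_def sum_list_triv)
  have set: "set (C us) = (\<lambda>(u, j). r u j) ` (set us \<times> {..<m})" for us
    by (auto simp: C_def)
  have r0: "0 \<le> r u j" for u j
    unfolding r_def using cos_ge_minus_one[of "(arccos (u / y) + 2 * pi * real j) / real m"] by linarith
  show ?thesis
  proof (rule moment_gapI[where xs = "C xs" and ys = "C ys" and y = 2])
    fix p :: "real poly" assume p: "degree p \<le> m * Suc k - 1"
    let ?p = "pcompose p [:1, 1:]"
    have "degree ?p < m * Suc k" using p assms(2) by (simp add: degree_pcompose)
    then obtain g where g: "degree g \<le> k"
      "\<And>x. (\<Sum>j<m. poly ?p (cos ((x + 2 * pi * real j) / real m))) = poly g (cos x)"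
      using sum_poly_cos_rotations[of m ?p k] assms(2) by auto
    have C: "(\<Sum>z\<leftarrow>C us. poly p z) = (\<Sum>u\<leftarrow>us. poly (pcompose g [:0, 1 / y:]) u)"
      if "\<And>u. u \<in> set us \<Longrightarrow> 0 \<le> u \<and> u \<le> y" for us
    proof -
      have "(\<Sum>j\<leftarrow>[0..<m]. poly p (r u j)) = poly (pcompose g [:0, 1 / y:]) u" if "u \<in> set us" for u
      proof -
        have "0 \<le> u / y" "u / y \<le> 1" using that \<open>\<And>u. u \<in> set us \<Longrightarrow> 0 \<le> u \<and> u \<le> y\<close> *(7) by auto
        then have "cos (arccos (u / y)) = u / y" by (intro cos_arccos) auto
        then show ?thesis using g(2)[of "arccos (u / y)"]
          by (simp add: r_def poly_pcompose interv_sum_list_conv_sum_set_nat atLeast0LessThan del: upt_Suc)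
      qed
      then show ?thesis unfolding C_def sum_list_concat_map map_map o_def
        by (intro arg_cong[of _ _ sum_list] map_cong) auto
    qed
    have "degree (pcompose g [:0, 1 / y:]) \<le> k" using g(1) by (simp add: degree_pcompose)
    from *(5)[OF this] show "(\<Sum>z\<leftarrow>C xs. poly p z) = (\<Sum>z\<leftarrow>C ys. poly p z)"
      using C[of xs] C[of ys] *(3,4,7,8,9) by force
  next
    have "r y 0 = 2" using *(7) by (simp add: r_def)
    then show "2 \<in> set (C ys)" using *(6) assms(2) unfolding set by (intro image_eqI[of _ _ "(y, 0)"]) auto
  next
    fix z assume "z \<in> set (C xs)"
    then obtain u j where z: "u \<in> set xs" "j < m" "z = r u j" unfolding set by auto
    define t where "t = arccos (u / y)"
    have u: "0 \<le> u / y" "u / y \<le> 1 / 2" using *(3,7,8) z(1) by (auto simp: divide_simps mult.commute)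
    have "arccos (1 / 2) = pi / 3" using arccos_cos[of "pi / 3"] by (simp add: cos_60)
    then have t1: "pi / 3 \<le> t" using u arccos_le_arccos[of "u / y" "1 / 2"] by (simp add: t_def)
    have t2: "t \<le> pi" using u order_trans[OF u(2), of 1] by (simp add: t_def arccos_ubound)
    have j: "real j \<le> real m - 1" using z(2) by linarith
    have "2 * pi * real j \<le> 2 * pi * (real m - 1)" using j by (intro mult_left_mono) auto
    also have "\<dots> = real m * (2 * pi) - 2 * pi" by (simp add: algebra_simps)
    finally have "t + 2 * pi * real j \<le> real m * (2 * pi) - pi / 3"
      using t2 pi_gt_zero by linarith
    then have "(t + 2 * pi * real j) / real m \<le> (real m * (2 * pi) - pi / 3) / real m"
      by (intro divide_right_mono) auto
    then have a2: "(t + 2 * pi * real j) / real m \<le> 2 * pi - pi / (3 * real m)"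
      using assms(2) by (simp add: diff_divide_distrib)
    have "(pi / 3) / real m \<le> (t + 2 * pi * real j) / real m"
      using t1 by (intro divide_right_mono) (auto simp: add_increasing2)
    then have a1: "pi / (3 * real m) \<le> (t + 2 * pi * real j) / real m" by simp
    have "z \<le> 1 + cos (pi / (3 * real m))"
      using cos_le_cos_of_between[OF _ a1 a2] by (simp add: z(3) r_def t_def)
    also have "\<dots> \<le> 2 - 1 / (2 * (real m)\<^sup>2)" using cos_pi_div_le_one_minus[OF assms(2)] by simp
    \<comment> \<open>With \<open>s = 1 / (4 * m^2)\<close> this is
      \<open>(1 + s) * (2 - 2 * s) = 2 - 2 * s^2\<close>.\<close>
    finally have "(1 + 1 / (4 * (real m)\<^sup>2)) * z \<le> (1 + 1 / (4 * (real m)\<^sup>2)) * (2 - 1 / (2 * (real m)\<^sup>2))"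
      by (intro mult_left_mono) auto
    also have "\<dots> = 2 - (1 / (4 * (real m)\<^sup>2)) * (1 / (2 * (real m)\<^sup>2))" by (simp add: algebra_simps)
    also have "\<dots> \<le> 2" by simp
    finally show "(1 + 1 / (4 * (real m)\<^sup>2)) * z \<le> 2" .
  qed (use * r0 in \<open>auto simp: len set\<close>)
qed

section \<open>Newton's identities\<close>

lemma elem_sym_eq_fps_nth:
  "elem_sym n i \<mu> = fps_nth (\<Prod>j\<in>{1..n}. fps_const (\<mu> j) * fps_X + 1) i"
proof -
  have const: "(\<Prod>j\<in>T. fps_const (\<mu> j)) = fps_const (\<Prod>j\<in>T. \<mu> j)" for T
    by (induction T rule: infinite_finite_induct) auto
  have "(\<Prod>j\<in>{1..n}. fps_const (\<mu> j) * fps_X + 1) =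
      (\<Sum>T\<in>Pow {1..n}. fps_const (\<Prod>j\<in>T. \<mu> j) * fps_X ^ card T)"
    by (subst prod_add) (auto simp: prod.distrib const intro!: sum.cong)
  then have "fps_nth (\<Prod>j\<in>{1..n}. fps_const (\<mu> j) * fps_X + 1) i =
      (\<Sum>T\<in>Pow {1..n}. if card T = i then \<Prod>j\<in>T. \<mu> j else 0)"
    by (auto simp: fps_sum_nth intro!: sum.cong)
  also have "\<dots> = elem_sym n i \<mu>"
    unfolding elem_sym_def by (subst sum.inter_filter [symmetric]) (auto intro!: sum.cong)
  finally show ?thesis ..
qed

text \<open>This is the logarithmic derivative of the generating function, with the inverse of each
  linear factor written as a geometric series.\<close>

lemma fps_deriv_prod_linear:
  fixes \<mu> :: "'a \<Rightarrow> real"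
  assumes "finite A"
  defines "P \<equiv> (\<lambda>A. \<Prod>j\<in>A. fps_const (\<mu> j) * fps_X + 1)"
  shows "fps_deriv (P A) = P A * (\<Sum>j\<in>A. fps_const (\<mu> j) * Abs_fps (\<lambda>i. (- \<mu> j) ^ i))"
  using assms(1)
proof (induction A rule: finite_induct)
  case (insert a A)
  have inv: "(fps_const c * fps_X + 1) * Abs_fps (\<lambda>i. (- c) ^ i) = 1" for c :: real
  proof (rule fps_ext)
    show "fps_nth ((fps_const c * fps_X + 1) * Abs_fps (\<lambda>i. (- c) ^ i)) i = fps_nth 1 i" for i
      by (cases i) (simp_all add: distrib_right mult.assoc)
  qed
  define L where "L = fps_const (\<mu> a) * fps_X + 1"
  define G where "G = Abs_fps (\<lambda>i. (- \<mu> a) ^ i)"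
  define S where "S = (\<Sum>j\<in>A. fps_const (\<mu> j) * Abs_fps (\<lambda>i. (- \<mu> j) ^ i))"
  have LG: "L * G = 1" using inv by (simp add: L_def G_def)
  have "fps_deriv (L * P A) = fps_const (\<mu> a) * P A + L * (P A * S)"
    using insert.IH by (simp add: L_def S_def)
  also have "\<dots> = fps_const (\<mu> a) * (L * G) * P A + L * (P A * S)" by (simp add: LG)
  also have "\<dots> = L * P A * (fps_const (\<mu> a) * G + S)" by (simp only: algebra_simps)
  finally show ?case using insert.hyps by (simp add: P_def L_def G_def S_def)
qed (simp add: P_def)

lemma newton_elem_sym:
  "real (Suc i) * elem_sym n (Suc i) \<mu> =
    (\<Sum>l=0..i. elem_sym n l \<mu> * ((-1) ^ (i - l) * (\<Sum>j=1..n. \<mu> j ^ Suc (i - l))))"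
proof -
  have "fps_nth (\<Sum>j=1..n. fps_const (\<mu> j) * Abs_fps (\<lambda>i. (- \<mu> j) ^ i)) l =
      (-1) ^ l * (\<Sum>j=1..n. \<mu> j ^ Suc l)" for l
    by (simp add: fps_sum_nth power_minus[of "\<mu> _"] sum_distrib_left algebra_simps)
  then show ?thesis
    using arg_cong[OF fps_deriv_prod_linear[of "{1..n}" \<mu>], of "\<lambda>F. fps_nth F i"]
    by (simp add: fps_mult_nth elem_sym_eq_fps_nth)
qed

text \<open>Newton's identity determines \<open>elem_sym n (Suc i)\<close> from earlier ones and
  power sums of exponent at most \<open>Suc i\<close>, since \<open>real (Suc i)\<close> can be
  cancelled.\<close>

lemma elem_sym_eq_if_power_sums_eq:
  assumes "\<And>i. i \<in> {1..k} \<Longrightarrow> (\<Sum>j=1..n. \<mu> j ^ i) = (\<Sum>j=1..n. \<nu> j ^ i)"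
  shows "i \<le> k \<Longrightarrow> elem_sym n i \<mu> = elem_sym n i \<nu>"
proof (induction i rule: less_induct)
  case (less i)
  show ?case
  proof (cases i)
    case 0
    have "{T. T \<subseteq> {1..n} \<and> card T = 0} = {{}}" by (auto dest: finite_subset)
    then show ?thesis by (simp add: 0 elem_sym_def)
  next
    case (Suc i')
    have "real (Suc i') * elem_sym n (Suc i') \<mu> = real (Suc i') * elem_sym n (Suc i') \<nu>"
      unfolding newton_elem_sym
    proof (rule sum.cong[OF refl])
      fix l assume l: "l \<in> {0..i'}"
      have "elem_sym n l \<mu> = elem_sym n l \<nu>" using less Suc l by auto
      moreover have "(\<Sum>j=1..n. \<mu> j ^ Suc (i' - l)) = (\<Sum>j=1..n. \<nu> j ^ Suc (i' - l))"
        using less Suc l by (intro assms) auto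
      ultimately show "elem_sym n l \<mu> * ((-1) ^ (i' - l) * (\<Sum>j=1..n. \<mu> j ^ Suc (i' - l))) =
          elem_sym n l \<nu> * ((-1) ^ (i' - l) * (\<Sum>j=1..n. \<nu> j ^ Suc (i' - l)))" by (simp only:)
    qed
    then show ?thesis by (simp add: Suc)
  qed
qed

section \<open>From lists to vectors\<close>

lemma moment_gap_imp_elem_sym:
  assumes "moment_gap k n B" "1 \<le> k"
  shows "\<exists>\<mu> \<nu>. (\<forall>j\<in>{1..n}. 0 \<le> \<mu> j) \<and> (\<forall>j\<in>{1..n}. 0 \<le> \<nu> j) \<and>
    (\<forall>i\<in>{1..k}. elem_sym n i \<mu> = elem_sym n i \<nu>) \<and> B \<le> vec_max n \<nu> / vec_max n \<mu>"
  using assms(1)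
proof (rule moment_gapE)
  fix xs ys :: "real list" and y :: real
  assume *: "length xs = n" "length ys = n" "\<And>x. x \<in> set xs \<Longrightarrow> 0 \<le> x" "\<And>y. y \<in> set ys \<Longrightarrow> 0 \<le> y"
    "\<And>p. degree p \<le> k \<Longrightarrow> (\<Sum>x\<leftarrow>xs. poly p x) = (\<Sum>y\<leftarrow>ys. poly p y)"
    "y \<in> set ys" "0 < y" "\<And>x. x \<in> set xs \<Longrightarrow> B * x \<le> y"
  define V where "V us j = us ! (j - 1)" for us :: "real list" and j
  have im: "V us ` {1..length us} = set us" for us
  proof -
    have "{1..length us} = Suc ` {..<length us}" by (simp add: image_Suc_lessThan)
    then show ?thesis by (auto simp: V_def set_conv_nth image_image)
  qed
  have sumV: "(\<Sum>j=1..length us. f (V us j)) = (\<Sum>u\<leftarrow>us. f u)" for us and f :: "real \<Rightarrow> real"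
    unfolding V_def sum_list_sum_nth
    by (rule sum.reindex_bij_witness[of _ Suc "\<lambda>j. j - 1"]) auto
  have pow: "(\<Sum>j=1..n. V xs j ^ i) = (\<Sum>j=1..n. V ys j ^ i)" if "i \<in> {1..k}" for i
    using *(5)[of "monom 1 i"] that sumV[of "\<lambda>u. u ^ i" xs] sumV[of "\<lambda>u. u ^ i" ys] *(1,2)
    by (simp add: poly_monom degree_monom_eq)
  have "B \<le> vec_max n (V ys) / vec_max n (V xs)"
  proof -
    have ne: "set xs \<noteq> {}" using *(1,2,6) by auto
    have My: "y \<le> Max (set ys)" using *(6) by simp
    have Mx: "Max (set xs) \<in> set xs" using ne by simp
    \<comment> \<open>The quotient needs a positive denominator. If \<open>xs\<close> were all zero,
      the first moment, available since \<open>1 \<le> k\<close>, would force all of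
      \<open>ys\<close> to vanish.\<close>
    have "0 < Max (set xs)"
    proof (rule ccontr)
      assume "\<not> 0 < Max (set xs)"
      then have "x = 0" if "x \<in> set xs" for x
        using Max_ge[OF finite_set that] *(3)[OF that] by linarith
      then have "(\<Sum>x\<leftarrow>xs. x) = 0" using *(3) by (simp add: sum_list_nonneg_eq_0_iff)
      then have "(\<Sum>y\<leftarrow>ys. y) = 0" using *(5)[of "[:0, 1:]"] assms(2) by simp
      then have "y = 0" using *(4,6) by (simp add: sum_list_nonneg_eq_0_iff)
      then show False using *(7) by simp
    qed
    then have "B \<le> Max (set ys) / Max (set xs)"
      using *(8)[OF Mx] My by (simp add: pos_le_divide_eq)
    then show ?thesis using im[of xs] im[of ys] *(1,2) by (simp add: vec_max_def)
  qed
  moreover have "\<forall>j\<in>{1..n}. 0 \<le> V xs j" "\<forall>j\<in>{1..n}. 0 \<le> V ys j"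
    using *(1-4) by (auto simp: V_def)
  moreover have "\<forall>i\<in>{1..k}. elem_sym n i (V xs) = elem_sym n i (V ys)"
    using elem_sym_eq_if_power_sums_eq[where \<mu> = "V xs" and \<nu> = "V ys", OF pow] by (meson atLeastAtMost_iff)
  ultimately show ?thesis by blast
qed

section \<open>Choice of parameters\<close>

lemma ln_81_le: "ln (81::real) \<le> 8"
proof -
  have "ln (81::real) = 4 * ln 3" using ln_realpow[of "3::real" 4] by simp
  then show ?thesis using ln_le_minus_one[of "3::real"] by simp
qed

text \<open>For degree 0 only the lengths must agree, so any ratio is possible; this seeds the
  Chebyshev step when \<open>n\<close> is of order \<open>k\<close>.\<close>

lemma moment_gap_zero: "moment_gap 0 1 B"
  by (rule moment_gapI[where xs = "[0]" and ys = "[1]" and y = 1]) (auto elim: degree_eq_zeroE)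

text \<open>\<open>K\<close> is maximal with \<open>81 ^ K * k \<le> n\<close>, so it is of order
  ln(n / k) when positive. Half of the base \<open>81 = 9 * 9\<close> pays for the pair of size
  \<open>9 ^ K\<close>, the other half for the factor \<open>m \<le> 9 ^ K * k\<close>.\<close>

lemma moment_gap_below:
  assumes "1 \<le> k" "k < n" "n < 81 ^ k"
  shows "moment_gap k n (1 + (ln (2 * real n / real k) / real k)\<^sup>2 / 10000)"
proof -
  let ?P = "\<lambda>K. n < 81 ^ K * k"
  have "n < (81::nat) ^ n" by (rule less_exp[THEN less_le_trans]) (simp add: power_mono)
  also have "\<dots> \<le> 81 ^ n * k" using assms(1) by simp
  finally obtain K where "\<forall>i\<le>K. \<not> ?P i" "?P (Suc K)"
    using ex_least_nat_less[of ?P n] assms(2) by auto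
  then have K: "81 ^ K * k \<le> n" "n < 81 ^ Suc K * k" by auto
  define q where "q = ln (2 * real n / real k)"
  have q0: "0 \<le> q" using assms(1,2) by (simp add: q_def)
  have "real n \<le> real (81 ^ Suc K * k)" using K(2) by (simp only: of_nat_le_iff less_imp_le)
  then have "2 * real n / real k \<le> 2 * 81 ^ Suc K" using assms(1) by (simp add: divide_simps mult_ac)
  also have "\<dots> \<le> 81 ^ (K + 2)" by simp
  finally have "q \<le> ln (81 ^ (K + 2))" unfolding q_def using assms by (subst ln_le_cancel_iff) auto
  also have "\<dots> = (real K + 2) * ln 81" by (subst ln_realpow) auto
  also have "\<dots> \<le> (real K + 2) * 8" using ln_81_le by (intro mult_left_mono) auto
  finally have q: "q \<le> 8 * real K + 16" by simp
  show ?thesis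
  proof (cases "K = 0")
    case True
    \<comment> \<open>Here \<open>n < 81 * k\<close> bounds \<open>q\<close> by 16, and
      \<open>Suc k\<close> preimages of the trivial pair already match all moments up to
      \<open>k\<close>.\<close>
    have "moment_gap k (Suc k) (1 + 1 / (4 * (real (Suc k))\<^sup>2))"
      using moment_gap_chebyshev[OF moment_gap_zero, of "Suc k"] by simp
    then show ?thesis
    proof (rule moment_gap_mono)
      have "q\<^sup>2 \<le> 16\<^sup>2" using q q0 True by (intro power_mono) auto
      then have "(q / real k)\<^sup>2 / 10000 \<le> 256 / (real k)\<^sup>2 / 10000"
        unfolding power_divide by (intro divide_right_mono) auto
      also have "\<dots> \<le> 1 / (4 * (2 * real k)\<^sup>2)"
        using assms(1) by (simp add: divide_simps)
      also have "\<dots> \<le> 1 / (4 * (real (Suc k))\<^sup>2)"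
        using assms(1) by (intro divide_left_mono mult_left_mono power_mono) auto
      finally show "1 + (ln (2 * real n / real k) / real k)\<^sup>2 / 10000 \<le> 1 + 1 / (4 * (real (Suc k))\<^sup>2)"
        by (simp add: q_def)
    qed (use assms in auto)
  next
    case False
    \<comment> \<open>The least \<open>m\<close> with \<open>k < m * K\<close>. As
      \<open>n < 81 ^ k\<close> forces \<open>K < k\<close>, rounding up costs at most a factor
      2.\<close>
    define m where "m = k div K + 1"
    have "(81::nat) ^ K \<le> 81 ^ K * k" using assms(1) by simp
    also have "\<dots> < 81 ^ k" using K(1) assms(3) by simp
    finally have Kk: "K < k" by simp
    have m1: "k < m * K" using False dividend_less_div_times[of K k] by (simp add: m_def algebra_simps)
    have "m * K \<le> k + K" by (simp add: m_def algebra_simps)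
    then have m2: "m * K \<le> 2 * k" using Kk by simp
    have "m \<le> k + 1" by (simp add: m_def)
    then have "m \<le> 9 * k" using assms(1) by simp
    also have "(9::nat) * k \<le> 9 ^ K * k" using False by (intro mult_right_mono self_le_power) auto
    finally have "m \<le> 9 ^ K * k" .
    then have "9 ^ K * m \<le> 9 ^ K * (9 ^ K * k)" by simp
    also have "\<dots> = (9 * 9) ^ K * k" by (simp only: power_mult_distrib mult.assoc)
    also have "\<dots> \<le> n" using K(1) by simp
    finally have n: "9 ^ K * m \<le> n" .
    have "moment_gap (m * K - 1) (9 ^ K * m) (1 + 1 / (4 * (real m)\<^sup>2))"
      using moment_gap_chebyshev[OF moment_gap_two[of "K - 1"], of m] False by (simp add: m_def)
    then show ?thesis
    proof (rule moment_gap_mono)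
      \<comment> \<open>From \<open>q \<le> 24 * K\<close> and \<open>m * K \<le> 2 * k\<close>
        comes \<open>q / k \<le> 48 / m\<close>; the constant 10000 suffices because
        \<open>48^2 = 2304 \<le> 10000 / 4\<close>.\<close>
      have mK: "real m * real K \<le> 2 * real k" using m2 by (metis of_nat_le_iff of_nat_mult of_nat_numeral)
      have "q \<le> 24 * real K" using q False by simp
      then have "q * real m \<le> 24 * real K * real m" by (intro mult_right_mono) auto
      also have "\<dots> \<le> 48 * real k" using mK by (simp add: mult.commute)
      finally have "q / real k \<le> 48 / real m"
        using assms(1) by (simp add: divide_simps m_def mult.commute)
      then have "(q / real k)\<^sup>2 \<le> (48 / real m)\<^sup>2" using q0 by (intro power_mono) auto
      then have "(q / real k)\<^sup>2 / 10000 \<le> 2304 / (real m)\<^sup>2 / 10000" by (simp add: power_divide)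
      also have "\<dots> \<le> 1 / (4 * (real m)\<^sup>2)" by (simp add: divide_simps m_def)
      finally show "1 + (ln (2 * real n / real k) / real k)\<^sup>2 / 10000 \<le> 1 + 1 / (4 * (real m)\<^sup>2)"
        by (simp add: q_def)
    qed (use m1 n in auto)
  qed
qed

text \<open>With \<open>r\<close> maximal such that \<open>81 ^ (k * r) \<le> n\<close>, the
  \<open>r\<close>-fold product fits, as \<open>k + 1 \<le> 2 * k\<close>. Maximality gives
  \<open>ln n \<le> 16 * k * r\<close>, so the exponent \<open>1 / (32 * k)\<close> yields at most
  exp(r / 2), which is below \<open>2 ^ r\<close>.\<close>

lemma moment_gap_above:
  assumes "1 \<le> k" "81 ^ k \<le> n"
  shows "moment_gap k n (real n powr (1 / 32 / real k))"
proof -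
  let ?P = "\<lambda>r. n < (81 ^ k) ^ r"
  have n0: "0 < n" using assms(2) one_le_power[of "81::nat" k] by linarith
  have "n < 2 ^ n" by (rule less_exp)
  also have "(2::nat) ^ n \<le> (81 ^ k) ^ n" using assms(1) self_le_power[of "81::nat" k] by (intro power_mono) auto
  finally have "?P n" .
  moreover have "\<not> ?P 0" using n0 by simp
  ultimately obtain r where "\<forall>i\<le>r. \<not> ?P i" "?P (Suc r)" using ex_least_nat_less[of ?P n] by auto
  then have r: "(81 ^ k) ^ r \<le> n" "n < (81 ^ k) ^ Suc r" by auto
  have "r \<noteq> 0" using r(2) assms(2) by (intro notI) simp
  then have r1: "1 \<le> r" by simp
  have "real n \<le> 81 ^ (k * Suc r)" 
  proof -
    have "real n \<le> real ((81 ^ k) ^ Suc r)" using r(2) by (simp only: of_nat_le_iff less_imp_le)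
    then show ?thesis by (simp only: power_mult of_nat_power of_nat_numeral)
  qed
  then have "ln (real n) \<le> ln (81 ^ (k * Suc r))" using n0 by (subst ln_le_cancel_iff) auto
  also have "\<dots> = real (k * Suc r) * ln 81" by (subst ln_realpow) auto
  also have "\<dots> \<le> real (k * Suc r) * 8" using ln_81_le by (intro mult_left_mono) auto
  also have "\<dots> \<le> real (k * (2 * r)) * 8" using r1
    by (intro mult_right_mono of_nat_mono mult_left_mono) auto
  finally have "ln (real n) \<le> 16 * real k * real r" by simp
  then have "1 / 32 / real k * ln (real n) \<le> 1 / 32 / real k * (16 * real k * real r)"
    by (intro mult_left_mono) auto
  also have "\<dots> = real r * (1 / 2)" using assms(1) by simp
  also have "\<dots> \<le> real r * ln 2" using ln2_ge_two_thirds by (intro mult_left_mono) auto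
  finally have "exp (1 / 32 / real k * ln (real n)) \<le> exp (real r * ln 2)" by simp
  then have B: "real n powr (1 / 32 / real k) \<le> 2 ^ r"
    using n0 by (simp add: powr_def exp_of_nat_mult)
  have "(9::nat) ^ Suc k \<le> 9 ^ (2 * k)" using assms(1) by (intro power_increasing) auto
  also have "\<dots> = 81 ^ k" by (simp add: power_mult)
  finally have "((9::nat) ^ Suc k) ^ r \<le> (81 ^ k) ^ r" by (rule power_mono) simp
  then have "(9 ^ Suc k) ^ r \<le> n" using r(1) by linarith
  then show ?thesis
    by (intro moment_gap_mono[OF moment_gap_power[OF moment_gap_two[of k] _ r1] _ _ B]) auto
qed

text \<open>The constructions switch at \<open>n = 81 ^ k\<close>, the bound at
  \<open>n = exp k\<close>. In the range between, \<open>moment_gap_below\<close> must beat the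
  power bound, which there is at most \<open>exp (8 * c)\<close>.\<close>

lemma moment_gap_gap_bound:
  assumes "1 \<le> k" "k < n"
  shows "moment_gap k n (gap_bound (1 / 1000000) k n)"
proof -
  let ?c = "1 / 1000000 :: real"
  define q where "q = ln (2 * real n / real k)"
  have n0: "0 < real n" and k0: "0 < real k" using assms by auto
  consider "\<not> real k \<le> ln (real n)" | "real k \<le> ln (real n)" "81 ^ k \<le> n" | "real k \<le> ln (real n)" "n < 81 ^ k"
    by linarith
  then show ?thesis
  proof cases
    case 1
    have "real n < exp (real k)" using 1 n0 by (metis exp_less_mono exp_ln not_le)
    also have "exp (real k) = exp 1 ^ k" by (simp flip: exp_of_nat_mult)
    also have "\<dots> \<le> 81 ^ k" using exp_le by (intro power_mono) auto
    finally have "n < 81 ^ k" by (metis of_nat_less_iff of_nat_numeral of_nat_power)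
    then have "moment_gap k n (1 + (q / real k)\<^sup>2 / 10000)"
      using moment_gap_below assms by (simp add: q_def)
    then show ?thesis
    proof (rule moment_gap_mono)
      have "gap_bound ?c k n = 1 + ?c * (q / real k)\<^sup>2" using 1 by (simp add: gap_bound_def q_def)
      moreover have "?c * (q / real k)\<^sup>2 \<le> (q / real k)\<^sup>2 / 10000"
        using mult_right_mono[of ?c "1 / 10000" "(q / real k)\<^sup>2"] by simp
      ultimately show "gap_bound ?c k n \<le> 1 + (q / real k)\<^sup>2 / 10000" by simp
    qed auto
  next
    case 2
    have "real n powr (?c / real k) \<le> real n powr (1 / 32 / real k)"
      using assms by (intro powr_mono divide_right_mono) auto
    then show ?thesis
      by (intro moment_gap_mono[OF moment_gap_above[OF assms(1) 2(2)]]) (use 2(1) in \<open>auto simp: gap_bound_def\<close>)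
  next
    case 3
    have "real n \<le> 81 ^ k" using 3(2) by (metis of_nat_le_iff of_nat_numeral of_nat_power less_imp_le)
    then have "ln (real n) \<le> ln (81 ^ k)" using n0 by (subst ln_le_cancel_iff) auto
    also have "\<dots> = real k * ln 81" by (subst ln_realpow) auto
    also have "\<dots> \<le> real k * 8" using ln_81_le by (intro mult_left_mono) auto
    finally have "?c / real k * ln (real n) \<le> ?c / real k * (real k * 8)" by (intro mult_left_mono) auto
    also have "\<dots> = 8 * ?c" using k0 by simp
    finally have "real n powr (?c / real k) \<le> exp (8 * ?c)" using n0 by (simp add: powr_def)
    also have "\<dots> \<le> 1 + 8 * ?c + (8 * ?c)\<^sup>2" by (rule exp_bound) auto
    \<comment> \<open>This comparison is what asks for a constant as small as
      \<open>1 / 1000000\<close>: \<open>8 * c + 64 * c^2\<close> must not exceed 1 / 40000.\<close>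
    also have "\<dots> \<le> 1 + (1 / 2)\<^sup>2 / 10000" by (simp add: power2_eq_square)
    also have "\<dots> \<le> 1 + (q / real k)\<^sup>2 / 10000"
    proof -
      \<comment> \<open>Splitting off \<open>k / 2\<close> and using \<open>k \<le> ln n\<close>
        gives \<open>q \<ge> k - (k / 2 - 1)\<close>.\<close>
      have "q = ln (real n) - ln (real k / 2)" using n0 k0 by (simp add: q_def ln_div ln_mult)
      moreover have "ln (real k / 2) \<le> real k / 2 - 1" using k0 by (intro ln_le_minus_one) auto
      ultimately have "1 / 2 * real k \<le> q" using 3(1) by linarith
      then have "1 / 2 \<le> q / real k" using k0 by (simp add: pos_le_divide_eq)
      then have "(1 / 2)\<^sup>2 \<le> (q / real k)\<^sup>2" by (intro power_mono) auto
      then show ?thesis by simp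
    qed
    finally show ?thesis
      by (intro moment_gap_mono[OF moment_gap_below[OF assms 3(2)]])
        (use 3(1) in \<open>auto simp: gap_bound_def q_def\<close>)
  qed
qed

theorem theorem3p2:
  shows "\<exists>c::real. c > 0 \<and>
    (\<forall>k n :: nat. 1 \<le> k \<and> k < n \<longrightarrow>
      (\<exists>\<mu> \<nu> :: nat \<Rightarrow> real.
         (\<forall>j\<in>{1..n}. 0 \<le> \<mu> j) \<and> (\<forall>j\<in>{1..n}. 0 \<le> \<nu> j) \<and>
         (\<forall>i\<in>{1..k}. elem_sym n i \<mu> = elem_sym n i \<nu>) \<and>
         vec_max n \<nu> / vec_max n \<mu> \<ge> gap_bound c k n))"
proof (intro exI[of _ "1 / 1000000"] conjI allI impI)
  fix k n :: nat
  assume "1 \<le> k \<and> k < n"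
  then show "\<exists>\<mu> \<nu> :: nat \<Rightarrow> real.
      (\<forall>j\<in>{1..n}. 0 \<le> \<mu> j) \<and> (\<forall>j\<in>{1..n}. 0 \<le> \<nu> j) \<and>
      (\<forall>i\<in>{1..k}. elem_sym n i \<mu> = elem_sym n i \<nu>) \<and>
      vec_max n \<nu> / vec_max n \<mu> \<ge> gap_bound (1 / 1000000) k n"
    using moment_gap_imp_elem_sym[OF moment_gap_gap_bound] by blast
qed simp

end
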